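(* Let $n=p_1p_2p_3$, where $p_1,p_2,p_3$ are three distinct primes, with $\gcd(n,6)=1$ and $n>1000$. Let $G$ be a cyclic group of order $n$, $g\in G$ with $\mathrm{ord}(g)=n$, and let $S=(x_1g)\cdot(x_2g)\cdot(x_3g)\cdot(x_4g)$, $1\le x_i\le n-1$, be a reduced minimal zero-sum sequence over $G$ such that (after renumbering the $x_i$ and the primes) one of the following holds: (A2) the multiset $\{\gcd(x_i,n): i=1,\dots,4\}$ equals $\{1,p_1,p_2,p_1p_2\}$; (A3) $\gcd(x_i,n)=1$ for $i=1,2,3,4$; (A4) $\gcd(x_1,n)=1$, $\gcd(x_2,n)=p_1p_2$, $\gcd(x_3,n)=p_1p_3$, $\gcd(x_4,n)=p_2p_3$. Then $\mathrm{ind}(S)=1$.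
   Context: A sequence over $G$ is a finite unordered list of elements of $G$ with repetition allowed. It is zero-sum if its terms sum to $0$, and minimal zero-sum if it is zero-sum and no proper nonempty subsequence is zero-sum. $S$ is reduced if for every prime $p\mid n$ the sequence $(px_1g)\cdot(px_2g)\cdot(px_3g)\cdot(px_4g)$ is not a minimal zero-sum sequence. For a generator $h$ of $G$, write $S=(m_1h)\cdots(m_4h)$ with $m_j\in[1,n]$ and set $\|S\|_h=(m_1+\cdots+m_4)/n$; $\mathrm{ind}(S)=\min\{\|S\|_h:\langle h\rangle=G\}$. *)

theory Defs
  imports
    Complex_Main
    "HOL-Library.Multiset"
    "HOL-Computational_Algebra.Primes"
    "HOL-Combinatorics.Permutations"
    "HOL-Algebra.Multiplicative_Group"
    "HOL-Algebra.Elementary_Groups"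
begin

text \<open>
  Groups are those of HOL-Algebra, so the abelian group of the paper is written
  multiplicatively: the multiple \<open>m g\<close> is \<open>g [^] m\<close>, and \<open>0\<close> is \<open>\<one>\<close>.
  A sequence over \<open>G\<close> is a finite multiset of elements of \<open>carrier G\<close>.
\<close>

text \<open>
  The product over a multiset is taken over its distinct elements, each raised to
  its multiplicity.
\<close>

definition seq_sum :: "('a, 'b) monoid_scheme \<Rightarrow> 'a multiset \<Rightarrow> 'a" where
  "seq_sum G S = finprod G (\<lambda>a. a [^]\<^bsub>G\<^esub> count S a) (set_mset S)"

definition zero_sum :: "('a, 'b) monoid_scheme \<Rightarrow> 'a multiset \<Rightarrow> bool" where
  "zero_sum G S \<longleftrightarrow> set_mset S \<subseteq> carrier G \<and> seq_sum G S = \<one>\<^bsub>G\<^esub>"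

definition minimal_zero_sum :: "('a, 'b) monoid_scheme \<Rightarrow> 'a multiset \<Rightarrow> bool" where
  "minimal_zero_sum G S \<longleftrightarrow>
     zero_sum G S \<and> (\<forall>T. T \<subset># S \<and> T \<noteq> {#} \<longrightarrow> \<not> zero_sum G T)"

definition multiples :: "('a, 'b) monoid_scheme \<Rightarrow> 'a \<Rightarrow> nat multiset \<Rightarrow> 'a multiset" where
  "multiples G g X = image_mset (\<lambda>m. g [^]\<^bsub>G\<^esub> m) X"

text \<open>
  This is a property of the sequence \<open>multiples G g X\<close>, given by its coefficients
  \<open>X\<close> with respect to \<open>g\<close>: multiplying them by \<open>p\<close> multiplies each term by \<open>p\<close>.
\<close>

definition reduced_seq :: "('a, 'b) monoid_scheme \<Rightarrow> 'a \<Rightarrow> nat multiset \<Rightarrow> bool" where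
  "reduced_seq G g X \<longleftrightarrow>
     (\<forall>p::nat. Factorial_Ring.prime p \<and> p dvd order G \<longrightarrow>
        \<not> minimal_zero_sum G (multiples G g (image_mset (\<lambda>m. p * m) X)))"

definition generators :: "('a, 'b) monoid_scheme \<Rightarrow> 'a set" where
  "generators G = {h \<in> carrier G. generate G {h} = carrier G}"

text \<open>
  The coefficient range starts at \<open>1\<close>, so the neutral element has coefficient
  \<open>order G\<close>. Existence and uniqueness hold when \<open>G\<close> is finite and \<open>h\<close> is a generator
  (see \<open>coefficient_iff\<close>).
\<close>

definition coefficient :: "('a, 'b) monoid_scheme \<Rightarrow> 'a \<Rightarrow> 'a \<Rightarrow> nat" where
  "coefficient G h a = (THE m. m \<in> {1..order G} \<and> h [^]\<^bsub>G\<^esub> m = a)"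

definition seq_norm :: "('a, 'b) monoid_scheme \<Rightarrow> 'a \<Rightarrow> 'a multiset \<Rightarrow> real" where
  "seq_norm G h S = real (\<Sum>a\<in>#S. coefficient G h a) / real (order G)"

definition seq_index :: "('a, 'b) monoid_scheme \<Rightarrow> 'a multiset \<Rightarrow> real" where
  "seq_index G S = Min ((\<lambda>h. seq_norm G h S) ` generators G)"

lemma coefficient_ex1:
  fixes G (structure)
  assumes "group G" "finite (carrier G)" "h \<in> generators G" "a \<in> carrier G"
  shows "\<exists>!m. m \<in> {1..order G} \<and> h [^] (m::nat) = a"
proof -
  interpret group G by fact
  have h: "h \<in> carrier G" "generate G {h} = carrier G"
    using assms(3) by (auto simp: generators_def)
  have o: "ord h = order G"
    using generate_pow_card[OF h(1)] h(2) by (simp add: order_def)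
  have "(\<lambda>m::nat. h [^] m) ` {1..order G} = carrier G"
  proof (rule card_subset_eq[OF assms(2)])
    show "(\<lambda>m::nat. h [^] m) ` {1..order G} \<subseteq> carrier G"
      using h(1) by auto
    show "card ((\<lambda>m::nat. h [^] m) ` {1..order G}) = card (carrier G)"
      using card_image[OF ord_inj'[OF h(1)]] by (simp add: o order_def)
  qed
  then have "a \<in> (\<lambda>m::nat. h [^] m) ` {1..order G}"
    using assms(4) by simp
  then obtain m :: nat where m: "m \<in> {1..order G}" "h [^] m = a"
    by blast
  show ?thesis
  proof (rule ex1I[of _ m])
    show "m \<in> {1..order G} \<and> h [^] m = a"
      using m by simp
  next
    fix k :: nat
    assume "k \<in> {1..order G} \<and> h [^] k = a"
    then show "k = m"
      using m inj_onD[OF ord_inj'[OF h(1)], of k m] by (simp add: o)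
  qed
qed

lemma coefficient_iff:
  fixes G (structure)
  assumes "group G" "finite (carrier G)" "h \<in> generators G" "a \<in> carrier G"
  shows "coefficient G h a = m \<longleftrightarrow> m \<in> {1..order G} \<and> h [^] m = a"
  unfolding coefficient_def
  using theI'[OF coefficient_ex1[OF assms]] the1_equality[OF coefficient_ex1[OF assms], of m]
  by metis

end

theory Submission
  imports Defs "HOL-Number_Theory.Cong"
begin

text \<open>
  If multiplying the reduced sequence \<open>S\<close> by a prime divisor \<open>p\<close> of \<open>n\<close> kills no term, then it
  makes the sum of a pair of terms vanish, so that some pair of coefficients has sum zero modulo
  \<open>n/p\<close>. In each of the three cases these congruences, together with the given gcds, determine
  all coefficients modulo every prime divisor of \<open>n\<close> from a coefficient \<open>x\<^sub>1\<close> coprime to \<open>n\<close>: each is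
  congruent to \<open>x\<^sub>1\<close>, \<open>-x\<^sub>1\<close> or \<open>0\<close>. Hence, up to a unit modulo \<open>n\<close>, there is a single sequence in
  each case, and an explicit unit brings its residues to sum \<open>n\<close>.
\<close>

section \<open>Zero-sum sequences written as multiples of one element\<close>

lemma (in comm_group) seq_sum_add_mset:
  assumes a: "a \<in> carrier G" and S: "set_mset S \<subseteq> carrier G"
  shows "seq_sum G (add_mset a S) = a \<otimes> seq_sum G S"
proof -
  \<comment> \<open>Taking \<open>a\<close> out of the support, whether or not it occurs there,
    makes \<open>finprod_insert\<close> applicable in both cases. If \<open>a\<close> is not in
    \<open>S\<close>, its factor \<open>f a\<close> is a zeroth power and equals the neutral
    element.\<close>
  define F where "F = set_mset S - {a}"
  define f where "f = (\<lambda>b. b [^] count S b)"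
  have F: "finite F" "a \<notin> F" "F \<subseteq> carrier G"
    using S by (auto simp: F_def)
  have f: "f \<in> F \<rightarrow> carrier G" "f a \<in> carrier G"
    using F a by (auto simp: f_def)
  have "seq_sum G (add_mset a S) = (a [^] Suc (count S a)) \<otimes> finprod G (\<lambda>b. b [^] count (add_mset a S) b) F"
  proof -
    have "set_mset (add_mset a S) = insert a F" by (auto simp: F_def)
    then show ?thesis
      unfolding seq_sum_def using F a by (simp only:) (subst finprod_insert, auto)
  qed
  also have "finprod G (\<lambda>b. b [^] count (add_mset a S) b) F = finprod G f F"
    using F f by (intro finprod_cong') (auto simp: f_def)
  also have "(a [^] Suc (count S a)) \<otimes> finprod G f F = a \<otimes> (f a \<otimes> finprod G f F)"
    using a F f by (simp add: f_def m_comm m_lcomm m_assoc)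
  also have "f a \<otimes> finprod G f F = seq_sum G S"
  proof (cases "a \<in># S")
    case True
    then have "set_mset S = insert a F" by (auto simp: F_def)
    then show ?thesis
      using F f by (simp add: seq_sum_def flip: f_def)
  next
    case False
    then have "set_mset S = F" "f a = \<one>" by (auto simp: F_def f_def not_in_iff)
    then show ?thesis
      using F f by (simp add: seq_sum_def flip: f_def)
  qed
  finally show ?thesis .
qed

lemma (in comm_group) seq_sum_multiples:
  assumes "g \<in> carrier G"
  shows "seq_sum G (multiples G g X) = g [^] (\<Sum>\<^sub># X)"
proof (induction X)
  case empty
  show ?case by (simp add: seq_sum_def multiples_def)
next
  case (add m X)
  have "set_mset (multiples G g X) \<subseteq> carrier G"
    using assms by (auto simp: multiples_def)
  with add assms show ?case
    by (simp add: seq_sum_add_mset nat_pow_mult multiples_def)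
qed

lemma (in comm_group) zero_sum_multiples:
  assumes "g \<in> carrier G"
  shows "zero_sum G (multiples G g X) \<longleftrightarrow> ord g dvd \<Sum>\<^sub># X"
proof -
  have "set_mset (multiples G g X) \<subseteq> carrier G"
    using assms by (auto simp: multiples_def)
  then show ?thesis
    using assms by (simp add: zero_sum_def seq_sum_multiples pow_eq_id)
qed

text \<open>Distinct coefficients may give the same term, so a subsequence can come from several
  sub-multisets of \<open>X\<close>. One preimage suffices: \<open>T\<close> is a summand of an
  image multiset, and such a splitting lifts to a splitting of \<open>X\<close>.\<close>

lemma (in comm_group) minimal_zero_sum_multiples:
  assumes "g \<in> carrier G"
  shows "minimal_zero_sum G (multiples G g X) \<longleftrightarrow>
    ord g dvd \<Sum>\<^sub># X \<and> (\<forall>Y. Y \<subset># X \<and> Y \<noteq> {#} \<longrightarrow> \<not> ord g dvd \<Sum>\<^sub># Y)"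
proof -
  have "(\<forall>T. T \<subset># multiples G g X \<and> T \<noteq> {#} \<longrightarrow> \<not> zero_sum G T) \<longleftrightarrow>
    (\<forall>Y. Y \<subset># X \<and> Y \<noteq> {#} \<longrightarrow> \<not> zero_sum G (multiples G g Y))" (is "?L = ?R")
  proof
    assume ?L
    then show ?R
      by (metis image_mset_is_empty_iff image_mset_subset_mono multiples_def)
  next
    assume R: ?R
    show ?L
    proof (intro allI impI)
      fix T assume T: "T \<subset># multiples G g X \<and> T \<noteq> {#}"
      then have "multiples G g X = T + (multiples G g X - T)"
        by (simp add: subset_mset.add_diff_inverse subset_mset.less_imp_le)
      then obtain Y Z where Y: "X = Y + Z" "T = multiples G g Y"
        unfolding multiples_def using image_mset_eq_plusD by metis
      have "Y \<noteq> X" "Y \<noteq> {#}"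
        using T Y(2) by (auto simp: multiples_def)
      with Y(1) have "Y \<subset># X" by (simp add: subset_mset.less_le)
      with R Y \<open>Y \<noteq> {#}\<close> show "\<not> zero_sum G T" by simp
    qed
  qed
  with assms show ?thesis
    by (simp add: minimal_zero_sum_def zero_sum_multiples)
qed

lemma subset_mset_four_cases:
  assumes "Y \<subset># {#a, b, c, d#}" "Y \<noteq> {#}"
  obtains "Y \<in> {{#a#}, {#b#}, {#c#}, {#d#}}"
  | "Y \<in> {{#a, b#}, {#a, c#}, {#a, d#}, {#c, d#}, {#b, d#}, {#b, c#}}"
  | "Y \<in> {{#b, c, d#}, {#a, c, d#}, {#a, b, d#}, {#a, b, c#}}"
proof -
  \<comment> \<open>Used as a rewrite rule, this recursion enumerates the sub-multisets of an
    explicit multiset.\<close>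
  have sub: "Z \<subseteq># add_mset x N \<longleftrightarrow> Z \<subseteq># N \<or> (\<exists>Z'. Z = add_mset x Z' \<and> Z' \<subseteq># N)"
    for Z N :: "'a multiset" and x
  proof
    assume Z: "Z \<subseteq># add_mset x N"
    show "Z \<subseteq># N \<or> (\<exists>Z'. Z = add_mset x Z' \<and> Z' \<subseteq># N)"
    proof (cases "x \<in># Z")
      case True
      then show ?thesis
        using Z by (metis insert_DiffM mset_subset_eq_add_mset_cancel)
    next
      case False
      then show ?thesis
        using Z by (metis Diff_eq_empty_iff_mset minus_add_mset_if_not_in_lhs)
    qed
  qed (auto intro: subset_mset.order_trans[of Z N "add_mset x N"])
  have "Y \<subseteq># {#a, b, c, d#}" "Y \<noteq> {#a, b, c, d#}"
    using assms by auto
  with assms(2) that show ?thesis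
    by (auto simp: sub)
qed

text \<open>The total is divisible by \<open>ord g\<close>, so a sub-multiset and its complement are
  zero-sum together. The triples thus reduce to single terms, and the six pairs to the three that
  contain \<open>a\<close>.\<close>

lemma (in comm_group) minimal_zero_sum_four:
  assumes g: "g \<in> carrier G" and sum: "ord g dvd a + b + c + d"
  shows "minimal_zero_sum G (multiples G g {#a, b, c, d#}) \<longleftrightarrow>
    \<not> ord g dvd a \<and> \<not> ord g dvd b \<and> \<not> ord g dvd c \<and> \<not> ord g dvd d \<and>
    \<not> ord g dvd a + b \<and> \<not> ord g dvd a + c \<and> \<not> ord g dvd a + d" (is "?L = ?R")
proof
  assume ?L
  then have *: "\<not> ord g dvd \<Sum>\<^sub># Y" if "Y \<subset># {#a, b, c, d#}" "Y \<noteq> {#}" for Y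
    using that by (auto simp: minimal_zero_sum_multiples[OF g])
  have sub: "Y \<subset># {#a, b, c, d#}" if "{#a, b, c, d#} = Y + Z" "Z \<noteq> {#}" for Y Z
    using that by (simp add: subset_mset.less_le)
  show ?R
    using *[OF sub[of "{#a#}" "{#b, c, d#}"]] *[OF sub[of "{#b#}" "{#a, c, d#}"]]
      *[OF sub[of "{#c#}" "{#a, b, d#}"]] *[OF sub[of "{#d#}" "{#a, b, c#}"]]
      *[OF sub[of "{#a, b#}" "{#c, d#}"]] *[OF sub[of "{#a, c#}" "{#b, d#}"]]
      *[OF sub[of "{#a, d#}" "{#b, c#}"]]
    by (simp add: add_mset_commute)
next
  assume R: ?R
  have compl: "ord g dvd u \<longleftrightarrow> ord g dvd v" if "u + v = a + b + c + d" for u v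
    using sum that by (metis dvd_add_right_iff dvd_add_left_iff)
  have "\<not> ord g dvd \<Sum>\<^sub># Y" if "Y \<subset># {#a, b, c, d#}" "Y \<noteq> {#}" for Y
    using that
    by (cases rule: subset_mset_four_cases)
      (use R compl[of "a + b" "c + d"] compl[of "a + c" "b + d"] compl[of "a + d" "b + c"]
        compl[of a "b + (c + d)"] compl[of b "a + (c + d)"] compl[of c "a + (b + d)"]
        compl[of d "a + (b + c)"] in auto)
  with sum show ?L
    by (simp add: minimal_zero_sum_multiples[OF g] add.assoc)
qed

text \<open>Scaling by \<open>p\<close> keeps the sum zero, so by reducedness one of the seven
  conditions of \<open>minimal_zero_sum_four\<close> fails for the scaled coefficients. Cancelling
  \<open>p\<close> from \<open>p * m\<close> leaves divisibility by \<open>m\<close>, and the single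
  terms are excluded by assumption.\<close>

lemma (in comm_group) reduced_pair:
  assumes g: "g \<in> carrier G" and n: "ord g = order G" "order G = p * m" and p: "Factorial_Ring.prime p"
    and sum: "order G dvd a + b + c + d"
    and red: "reduced_seq G g {#a, b, c, d#}"
    and ndvd: "\<not> m dvd a" "\<not> m dvd b" "\<not> m dvd c" "\<not> m dvd d"
  shows "m dvd a + b \<or> m dvd a + c \<or> m dvd a + d"
proof -
  have "p > 0" using p by (simp add: prime_gt_0_nat)
  have "\<not> minimal_zero_sum G (multiples G g {#p * a, p * b, p * c, p * d#})"
    using red p n by (simp add: reduced_seq_def)
  moreover have "ord g dvd p * a + p * b + p * c + p * d"
    using sum n by (metis dvd_mult distrib_left)
  ultimately show ?thesis
    using ndvd \<open>p > 0\<close> n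
    by (simp add: minimal_zero_sum_four[OF g] flip: distrib_left)
qed

section \<open>The index and units modulo the group order\<close>

text \<open>This is the lower bound 1 for the index: zero sum makes the sum of the coefficients a
  multiple of the order, and it is positive because each coefficient is at least 1.\<close>

lemma (in comm_group) coefficient_sum_ge:
  assumes fin: "finite (carrier G)" and h: "h \<in> generators G"
    and S: "zero_sum G S" "S \<noteq> {#}"
  shows "order G \<le> (\<Sum>a\<in>#S. coefficient G h a)"
proof -
  have hc: "h \<in> carrier G" "generate G {h} = carrier G"
    using h by (auto simp: generators_def)
  have o: "ord h = order G"
    using generate_pow_card[OF hc(1)] hc(2) by (simp add: order_def)
  have co: "coefficient G h a \<in> {1..order G}" "h [^] coefficient G h a = a" if "a \<in># S" for a
    using coefficient_iff[OF is_group fin h, of a "coefficient G h a"] S(1) that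
    by (auto simp: zero_sum_def)
  have "multiples G h (image_mset (coefficient G h) S) = S"
    using co(2) by (simp add: multiples_def multiset.map_comp comp_def multiset.map_ident_strong)
  with S(1) have "order G dvd (\<Sum>a\<in>#S. coefficient G h a)"
    using zero_sum_multiples[OF hc(1)] by (metis o)
  moreover from S(2) obtain a where "a \<in># S" by auto
  then have "(\<Sum>a\<in>#S. coefficient G h a) > 0"
    using co(1)[of a] by (auto simp: dest!: multi_member_split)
  ultimately show ?thesis by (simp add: dvd_imp_le)
qed

text \<open>Changing the generator amounts to multiplying the coefficients by a unit. With
  \<open>s\<close> inverse to \<open>t\<close> and \<open>h = g [^] s\<close>, the element
  \<open>g [^] m\<close> is the multiple of \<open>h\<close> by \<open>t * m\<close>.\<close>

lemma (in group) seq_norm_eqI: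
  assumes fin: "finite (carrier G)" and g: "g \<in> carrier G" "ord g = order G"
    and t: "coprime t (int (order G))"
    and nz: "\<forall>m\<in>#X. \<not> order G dvd m"
    and sum: "(\<Sum>m\<in>#X. t * int m mod int (order G)) = int (order G)"
  obtains h where "h \<in> generators G" "seq_norm G h (multiples G g X) = 1"
proof -
  define n where "n = order G"
  have n: "n > 0" using fin order_gt_0_iff_finite by (simp add: n_def)
  obtain s :: int where s: "[t * s = 1] (mod int n)"
    using cong_solve_coprime_int[OF t] by (auto simp: n_def)
  define h where "h = g [^] s"
  have hc: "h \<in> carrier G" using g by (simp add: h_def)
  have cs: "coprime s (int n)"
    using s by (metis coprime_iff_invertible_int mult.commute)
  have "ord h = n"
  proof (subst ord_unique[OF hc], intro allI)
    fix k :: nat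
    have "h [^] k = g [^] (s * int k)"
      using g int_pow_pow[of g s "int k"] by (simp add: h_def int_pow_int)
    also have "\<dots> = \<one> \<longleftrightarrow> int n dvd s * int k"
      using g by (simp add: int_pow_eq_id n_def)
    also have "\<dots> \<longleftrightarrow> n dvd k"
      using cs by (simp add: coprime_dvd_mult_right_iff coprime_commute)
    finally show "h [^] k = \<one> \<longleftrightarrow> n dvd k" .
  qed
  then have "card (generate G {h}) = card (carrier G)"
    using generate_pow_card[OF hc] by (simp add: n_def order_def)
  then have "generate G {h} = carrier G"
    using fin hc generate_incl[of "{h}"] by (intro card_subset_eq) auto
  then have gen: "h \<in> generators G"
    using hc by (simp add: generators_def)
  have co: "int (coefficient G h (g [^] m)) = t * int m mod int n" if "m \<in># X" for m
  proof -
    define k where "k = nat (t * int m mod int n)"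
    have k: "int k = t * int m mod int n"
      using n by (simp add: k_def)
    \<comment> \<open>Coefficients start at 1, so a zero residue would have coefficient
      \<open>n\<close>. Since \<open>nz\<close> excludes this, the residue is itself the
      coefficient.\<close>
    have "\<not> int n dvd t * int m"
      using nz that t by (simp add: n_def coprime_dvd_mult_right_iff coprime_commute)
    then have "k \<noteq> 0"
      using k by (simp add: dvd_eq_mod_eq_0)
    moreover have "k \<le> n"
      using n k by (simp add: k_def nat_le_iff less_imp_le)
    moreover have "h [^] k = g [^] m"
    proof -
      have "h [^] k = g [^] (s * int k)"
        using g int_pow_pow[of g s "int k"] by (simp add: h_def int_pow_int)
      also have "\<dots> = g [^] int m"
      proof -
        have "[s * int k = s * (t * int m)] (mod int n)"
          unfolding k by (intro cong_scalar_left) (simp add: cong_def)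
        also have "s * (t * int m) = (t * s) * int m" by simp
        also have "[(t * s) * int m = 1 * int m] (mod int n)"
          by (intro cong_scalar_right s)
        finally show ?thesis
          using g by (simp add: int_pow_eq n_def cong_iff_dvd_diff dvd_diff_commute)
      qed
      finally show ?thesis by (simp add: int_pow_int)
    qed
    ultimately have "coefficient G h (g [^] m) = k"
      using coefficient_iff[OF is_group fin gen, of "g [^] m" k] g by (simp add: n_def)
    with k show ?thesis by simp
  qed
  have "int (\<Sum>a\<in>#multiples G g X. coefficient G h a) = (\<Sum>m\<in>#X. int (coefficient G h (g [^] m)))"
    by (simp add: multiples_def multiset.map_comp comp_def)
  also have "\<dots> = int n"
    using co sum by (simp add: n_def cong: image_mset_cong)
  finally have "seq_norm G h (multiples G g X) = 1"
    using n by (simp only: seq_norm_def of_nat_eq_iff) (simp add: n_def)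
  with gen show ?thesis by (rule that)
qed

lemma (in comm_group) seq_index_eq_1I:
  assumes fin: "finite (carrier G)" and g: "g \<in> carrier G" "ord g = order G"
    and t: "coprime t (int (order G))"
    and nz: "\<forall>m\<in>#X. \<not> order G dvd m"
    and sum: "(\<Sum>m\<in>#X. t * int m mod int (order G)) = int (order G)"
    and zs: "zero_sum G (multiples G g X)"
  shows "seq_index G (multiples G g X) = 1"
proof -
  obtain h where h: "h \<in> generators G" "seq_norm G h (multiples G g X) = 1"
    using seq_norm_eqI[OF fin g t nz sum] .
  have n: "order G > 0" using fin order_gt_0_iff_finite by simp
  have "X \<noteq> {#}" using sum n by auto
  then have "seq_norm G k (multiples G g X) \<ge> 1" if "k \<in> generators G" for k
    using coefficient_sum_ge[OF fin that zs] n
    by (simp only: seq_norm_def le_divide_eq_1_pos of_nat_0_less_iff of_nat_le_iff)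
      (simp add: multiples_def)
  moreover have "finite (generators G)"
    using fin by (simp add: generators_def)
  ultimately show ?thesis
    unfolding seq_index_def
    using h by (intro Min_eqI) (auto simp: image_iff intro!: bexI[of _ h])
qed

section \<open>Residues modulo a product of three primes\<close>

text \<open>Integers allow congruences to \<open>-a\<close> and differences of products without
  truncated subtraction.\<close>

locale three_primes =
  fixes p q r n :: int
  assumes primes: "Factorial_Ring.prime p" "Factorial_Ring.prime q" "Factorial_Ring.prime r"
    and distinct: "p \<noteq> q" "p \<noteq> r" "q \<noteq> r"
    and n_eq: "n = p * q * r"
    and coprime_6: "coprime n 6"
begin

lemma coprimes: "coprime p q" "coprime p r" "coprime q r"
  using primes distinct by (simp_all add: primes_coprime)

lemma primes_ge_5: "p \<ge> 5" "q \<ge> 5" "r \<ge> 5"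
proof -
  have "k \<ge> 5" if "Factorial_Ring.prime k" "k dvd n" for k :: int
  proof (rule ccontr)
    assume "\<not> k \<ge> 5"
    moreover have "k > 1" using that(1) by (rule prime_gt_1_int)
    ultimately have "k = 2 \<or> k = 3 \<or> k = 4" by auto
    moreover have "coprime k 6"
      using that(2) coprime_6 by (rule coprime_divisors[OF _ dvd_refl])
    ultimately show False
      using coprime_common_divisor_int[of k 6 2] coprime_common_divisor_int[of k 6 3] by auto
  qed
  then show "p \<ge> 5" "q \<ge> 5" "r \<ge> 5"
    using primes by (simp_all add: n_eq)
qed

lemma dvd_nI:
  assumes "p dvd z" "q dvd z" "r dvd z"
  shows "n dvd z"
  unfolding n_eq using assms coprimes by (intro divides_mult) auto

text \<open>Chinese remaindering: modulo each prime only one of the three terms of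
  \<open>s * a\<close> survives. Multiplying by \<open>e1\<close>, \<open>e2\<close>,
  \<open>e3\<close> modulo the respective primes therefore multiplies the three terms separately,
  and the range of \<open>y\<close> makes it the residue.\<close>

lemma scaled_mod_eq:
  assumes sa: "[s * a = A * q * r + B * p * r + C * p * q] (mod n)"
    and x: "p dvd x - e1 * a" "q dvd x - e2 * a" "r dvd x - e3 * a"
    and y: "[y = e1 * A * q * r + e2 * B * p * r + e3 * C * p * q] (mod n)" "0 \<le> y" "y < n"
  shows "s * x mod n = y"
proof -
  define Y where "Y = e1 * A * q * r + e2 * B * p * r + e3 * C * p * q"
  define U where "U = A * q * r + B * p * r + C * p * q"
  have n: "n dvd s * a - U" "n dvd y - Y"
    using sa y(1) by (simp_all add: U_def Y_def cong_iff_dvd_diff)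
  have "k dvd s * x - y" if "k dvd n" "k dvd x - e * a" "k dvd e * U - Y" for k e
  proof -
    have "k dvd s * (x - e * a) + e * (s * a - U) + (e * U - Y) - (y - Y)"
      by (rule dvd_diff[OF dvd_add[OF dvd_add[OF dvd_mult[OF that(2)]
              dvd_mult[OF dvd_trans[OF that(1) n(1)]]] that(3)] dvd_trans[OF that(1) n(2)]])
    then show ?thesis
      by (simp add: algebra_simps)
  qed
  note dvd = this
  have "p dvd e1 * U - Y" "q dvd e2 * U - Y" "r dvd e3 * U - Y"
  proof -
    \<comment> \<open>In each difference the term free of the prime in question cancels, and the
      other two contain that prime.\<close>
    have "e1 * U - Y = p * ((e1 - e2) * B * r + (e1 - e3) * C * q)"
      "e2 * U - Y = q * ((e2 - e1) * A * r + (e2 - e3) * C * p)"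
      "e3 * U - Y = r * ((e3 - e1) * A * q + (e3 - e2) * B * p)"
      by (simp_all add: U_def Y_def algebra_simps)
    then show "p dvd e1 * U - Y" "q dvd e2 * U - Y" "r dvd e3 * U - Y"
      by simp_all
  qed
  then have "n dvd s * x - y"
    using x dvd[of p e1] dvd[of q e2] dvd[of r e3] by (intro dvd_nI) (simp_all add: n_eq)
  then have "s * x mod n = y mod n"
    by (simp add: mod_eq_dvd_iff)
  with y(2,3) show ?thesis by simp
qed

text \<open>Take \<open>s\<close> to be the prescribed value \<open>U\<close> times the inverse of
  \<open>a\<close>. Modulo each prime a single term of \<open>U\<close> survives and is nonzero, so
  \<open>U\<close> is a unit.\<close>

lemma scale_unit:
  assumes a: "coprime a n" and ndvd: "\<not> p dvd A" "\<not> q dvd B" "\<not> r dvd C"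
  obtains s where "coprime s n" "[s * a = A * q * r + B * p * r + C * p * q] (mod n)"
proof -
  define U where "U = A * q * r + B * p * r + C * p * q"
  obtain t where t: "[a * t = 1] (mod n)"
    using cong_solve_coprime_int[OF a] by blast
  have "\<not> p dvd q" "\<not> p dvd r" "\<not> q dvd p" "\<not> q dvd r" "\<not> r dvd p" "\<not> r dvd q"
    using primes distinct by (metis primes_dvd_imp_eq)+
  then have ndvd': "\<not> p dvd A * q * r" "\<not> q dvd B * p * r" "\<not> r dvd C * p * q"
    using ndvd primes by (simp_all add: prime_dvd_mult_iff)
  have U': "U = A * q * r + p * (B * r + C * q)" "U = B * p * r + q * (A * r + C * p)"
    "U = C * p * q + r * (A * q + B * p)"
    by (simp_all add: U_def algebra_simps)
  have "\<not> p dvd U" "\<not> q dvd U" "\<not> r dvd U"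
    using ndvd' by (subst U', simp add: dvd_add_left_iff)+
  then have "coprime p U" "coprime q U" "coprime r U"
    using primes by (simp_all add: prime_imp_coprime)
  then have U: "coprime U n"
    by (simp add: n_eq coprime_commute)
  have "[t * U * a = U] (mod n)"
    using cong_scalar_right[OF t, of U] by (simp add: ac_simps)
  moreover have "coprime t n"
    using t by (metis coprime_iff_invertible_int mult.commute)
  with U have "coprime (t * U) n" by simp
  ultimately show ?thesis
    using that[of "t * U"] by (simp add: U_def)
qed

text \<open>
  In the next three lemmas the divisibility hypotheses determine the coefficients up to a common
  unit modulo \<open>n\<close>. The unit is chosen so that the residue of the first coefficient, divided by
  \<open>n\<close>, is \<open>A/p + B/q + C/r\<close> modulo \<open>1\<close>. Here \<open>A = B = C = -1\<close> works.
\<close>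

lemma unit_norm_one_A4:
  assumes a: "coprime a n" and sum: "n dvd a + b + c + d"
    and "p * q dvd b" "p * r dvd c" "q * r dvd d"
  shows "\<exists>t. coprime t n \<and> t * a mod n + t * b mod n + t * c mod n + t * d mod n = n"
proof -
  have pqr: "p dvd b" "q dvd b" "p dvd c" "r dvd c" "q dvd d" "r dvd d"
    using assms(3-5) by (auto dest: dvd_mult_left dvd_mult_right)
  have "p dvd a + b + c + d" "q dvd a + b + c + d" "r dvd a + b + c + d"
    using sum by (auto simp: n_eq intro: dvd_trans)
  \<comment> \<open>Modulo each prime two of \<open>b\<close>, \<open>c\<close>, \<open>d\<close>
    vanish, so the third is congruent to \<open>-a\<close>.\<close>
  then have "p dvd a + b + c + d - b - c" "q dvd a + b + c + d - b - d"
    "r dvd a + b + c + d - c - d"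
    using pqr by (simp_all only: dvd_diff)
  then have *: "p dvd d - (-1) * a" "q dvd c - (-1) * a" "r dvd b - (-1) * a"
    by (simp_all add: add.commute)
  have "\<not> p dvd -1" "\<not> q dvd -1" "\<not> r dvd -1"
    using primes by (auto simp: not_prime_unit)
  then obtain s where s: "coprime s n" "[s * a = (-1) * q * r + (-1) * p * r + (-1) * p * q] (mod n)"
    by (rule scale_unit[OF a])
  \<comment> \<open>Each product of two primes is at most \<open>n / 5\<close>, so subtracting all
    three from \<open>n\<close> leaves a positive residue.\<close>
  have "5 * (q * r) \<le> n" "5 * (p * r) \<le> n" "5 * (p * q) \<le> n"
    using primes_ge_5 mult_right_mono[of 5 p "q * r"] mult_right_mono[of 5 q "p * r"]
      mult_right_mono[of 5 r "p * q"]
    by (simp_all add: n_eq ac_simps)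
  moreover have "q * r > 0" "p * r > 0" "p * q > 0"
    using primes_ge_5 by auto
  ultimately have bounds: "0 < q * r" "q * r < n" "0 < p * r" "p * r < n" "0 < p * q" "p * q < n"
    "0 < n - q * r - p * r - p * q"
    by auto
  have "s * a mod n = n - q * r - p * r - p * q"
    using bounds
    by (intro scaled_mod_eq[OF s(2), where ?e1.0 = 1 and ?e2.0 = 1 and ?e3.0 = 1])
      (auto simp: cong_iff_dvd_diff)
  moreover have "s * b mod n = p * q"
    using bounds pqr *
    by (intro scaled_mod_eq[OF s(2), where ?e1.0 = 0 and ?e2.0 = 0 and ?e3.0 = "-1"]) auto
  moreover have "s * c mod n = p * r"
    using bounds pqr *
    by (intro scaled_mod_eq[OF s(2), where ?e1.0 = 0 and ?e2.0 = "-1" and ?e3.0 = 0]) auto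
  moreover have "s * d mod n = q * r"
    using bounds pqr *
    by (intro scaled_mod_eq[OF s(2), where ?e1.0 = "-1" and ?e2.0 = 0 and ?e3.0 = 0]) auto
  ultimately have "s * a mod n + s * b mod n + s * c mod n + s * d mod n = n"
    by simp
  with s(1) show ?thesis by blast
qed

text \<open>Here \<open>A = -(p - 1)/2\<close>, \<open>B = -(q - 1)/2\<close> and \<open>C = 1\<close> work.\<close>

lemma unit_norm_one_A2:
  assumes a: "coprime a n" and sum: "n dvd a + b + c + d"
    and "p dvd b" "q dvd c" "p dvd d" "q dvd d" "q * r dvd a + b" "p * r dvd a + c"
  shows "\<exists>t. coprime t n \<and> t * a mod n + t * b mod n + t * c mod n + t * d mod n = n"
proof -
  have qr: "q dvd a + b" "r dvd a + b" "p dvd a + c" "r dvd a + c"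
    using assms(7,8) by (auto dest: dvd_mult_left dvd_mult_right)
  have "r dvd a + b + c + d"
    using sum by (auto simp: n_eq intro: dvd_trans)
  \<comment> \<open>The difference is \<open>d - a\<close>, so \<open>d\<close> agrees with
    \<open>a\<close> modulo \<open>r\<close>.\<close>
  then have "r dvd (a + b + c + d) - (a + b) - (a + c)"
    using qr by (intro dvd_diff)
  then have *: "r dvd d - 1 * a" "q dvd b - (-1) * a" "r dvd b - (-1) * a" "p dvd c - (-1) * a"
      "r dvd c - (-1) * a"
    using qr by (simp_all add: add.commute)
  have "odd p" "odd q"
    using primes primes_ge_5 by (auto simp: prime_odd_int)
  then obtain h k where hk: "p = 2 * h + 1" "q = 2 * k + 1"
    by (elim oddE)
  have hk2: "h \<ge> 2" "k \<ge> 2" using primes_ge_5 hk by auto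
  have "\<not> p dvd - h" "\<not> q dvd - k" "\<not> r dvd 1"
    using hk2 primes by (auto simp: hk not_prime_unit dest: zdvd_imp_le)
  then obtain s where s: "coprime s n" "[s * a = (- h) * q * r + (- k) * p * r + 1 * p * q] (mod n)"
    by (rule scale_unit[OF a])
  \<comment> \<open>By this identity the residue of \<open>a\<close> below equals
    \<open>r * (p + q) / 2 + p * q\<close>, which is positive.\<close>
  have "2 * (h * q * r + k * p * r) + r * (p + q) = 2 * n"
    by (simp add: n_eq hk algebra_simps)
  moreover have "r * (p + q) > 0" "p * q > 0"
    using primes_ge_5 by auto
  moreover have "k * p * r - p * q > 0"
  proof -
    \<comment> \<open>As \<open>r\<close> is at least 5, \<open>k * r\<close> exceeds
      \<open>2 * k + 1 = q\<close>.\<close>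
    have "5 * k \<le> k * r" using primes_ge_5 hk2 by simp
    then have "k * r - q > 0" using hk hk2 by linarith
    then have "p * (k * r - q) > 0" using primes_ge_5 by (intro mult_pos_pos) auto
    then show ?thesis by (simp add: algebra_simps)
  qed
  moreover have "h * q * r - p * q > 0"
  proof -
    have "5 * h \<le> h * r" using primes_ge_5 hk2 by simp
    then have "h * r - p > 0" using hk hk2 by linarith
    then have "q * (h * r - p) > 0" using primes_ge_5 by (intro mult_pos_pos) auto
    then show ?thesis by (simp add: algebra_simps)
  qed
  ultimately have bounds: "0 < p * q" "p * q < n" "0 < k * p * r - p * q" "k * p * r - p * q < n"
    "0 < h * q * r - p * q" "h * q * r - p * q < n"
    "0 < n - h * q * r - k * p * r + p * q" "n - h * q * r - k * p * r + p * q < n"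
    by auto
  have "s * a mod n = n - h * q * r - k * p * r + p * q"
    using bounds
    by (intro scaled_mod_eq[OF s(2), where ?e1.0 = 1 and ?e2.0 = 1 and ?e3.0 = 1])
      (auto simp: cong_iff_dvd_diff)
  moreover have "s * b mod n = k * p * r - p * q"
    using bounds assms(3) *
    by (intro scaled_mod_eq[OF s(2), where ?e1.0 = 0 and ?e2.0 = "-1" and ?e3.0 = "-1"]) auto
  moreover have "s * c mod n = h * q * r - p * q"
    using bounds assms(4) *
    by (intro scaled_mod_eq[OF s(2), where ?e1.0 = "-1" and ?e2.0 = 0 and ?e3.0 = "-1"]) auto
  moreover have "s * d mod n = p * q"
    using bounds assms(5,6) *
    by (intro scaled_mod_eq[OF s(2), where ?e1.0 = 0 and ?e2.0 = 0 and ?e3.0 = 1]) auto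
  ultimately have "s * a mod n + s * b mod n + s * c mod n + s * d mod n = n"
    by simp
  with s(1) show ?thesis by blast
qed

text \<open>The witness \<open>k div 6 + 1\<close> is the least integer above \<open>k / 6\<close>.
  For \<open>k \<ge> 5\<close> it lies below \<open>k / 3\<close> except at \<open>k = 6\<close>,
  which coprimality excludes.\<close>

lemma ex_between_sixth_third:
  assumes "k \<ge> 5" "coprime k 6"
  shows "\<exists>m::int. 0 < m \<and> k < 6 * m \<and> 3 * m < k"
proof (intro exI conjI)
  have "k mod 6 \<noteq> 0"
    using assms by (auto simp: coprime_iff_gcd_eq_1 mod_eq_0_iff_dvd gcd_proj2_if_dvd_int)
  then show "0 < k div 6 + 1" "k < 6 * (k div 6 + 1)" "3 * (k div 6 + 1) < k"
    using assms(1) by presburger+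
qed

text \<open>
  Here \<open>-A/p\<close>, \<open>-B/q\<close>, \<open>-C/r\<close> are taken strictly between \<open>1/6\<close> and \<open>1/3\<close>: they then satisfy
  the strict triangle inequalities and have sum less than \<open>1\<close>, which makes all four
  residues positive.
\<close>

lemma unit_norm_one_A3:
  assumes a: "coprime a n" and sum: "n dvd a + b + c + d"
    and "q * r dvd a + b" "p * r dvd a + c" "p * q dvd a + d"
  shows "\<exists>t. coprime t n \<and> t * a mod n + t * b mod n + t * c mod n + t * d mod n = n"
proof -
  have pqr: "q dvd a + b" "r dvd a + b" "p dvd a + c" "r dvd a + c" "p dvd a + d" "q dvd a + d"
    using assms(3-5) by (auto dest: dvd_mult_left dvd_mult_right)
  have "p dvd a + b + c + d" "q dvd a + b + c + d" "r dvd a + b + c + d"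
    using sum by (auto simp: n_eq intro: dvd_trans)
  \<comment> \<open>The three differences are \<open>b - a\<close>, \<open>c - a\<close> and
    \<open>d - a\<close>: each of \<open>b\<close>, \<open>c\<close>, \<open>d\<close> agrees with
    \<open>a\<close> modulo exactly the prime outside its own pair condition.\<close>
  then have "p dvd (a + b + c + d) - (a + c) - (a + d)" "q dvd (a + b + c + d) - (a + b) - (a + d)"
    "r dvd (a + b + c + d) - (a + b) - (a + c)"
    using pqr by (simp_all only: dvd_diff)
  then have *: "p dvd b - 1 * a" "q dvd b - (-1) * a" "r dvd b - (-1) * a"
      "p dvd c - (-1) * a" "q dvd c - 1 * a" "r dvd c - (-1) * a"
      "p dvd d - (-1) * a" "q dvd d - (-1) * a" "r dvd d - 1 * a"
    using pqr by (simp_all add: add.commute)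
  have "coprime p 6" "coprime q 6" "coprime r 6"
    using coprime_6 by (simp_all add: n_eq)
  with primes_ge_5 obtain i j k where ijk: "0 < i" "p < 6 * i" "3 * i < p"
    "0 < j" "q < 6 * j" "3 * j < q" "0 < k" "r < 6 * k" "3 * k < r"
    by (meson ex_between_sixth_third)
  have "\<not> p dvd - i" "\<not> q dvd - j" "\<not> r dvd - k"
    using ijk by (auto dest: zdvd_imp_le)
  then obtain s where s: "coprime s n" "[s * a = (- i) * q * r + (- j) * p * r + (- k) * p * q] (mod n)"
    by (rule scale_unit[OF a])
  have pos: "0 < q * r" "0 < p * r" "0 < p * q"
    using primes_ge_5 by auto
  have "n < 6 * (i * q * r)" "3 * (i * q * r) < n" "n < 6 * (j * p * r)" "3 * (j * p * r) < n"
    "n < 6 * (k * p * q)" "3 * (k * p * q) < n"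
    using mult_strict_right_mono[OF ijk(2) pos(1)] mult_strict_right_mono[OF ijk(3) pos(1)]
      mult_strict_right_mono[OF ijk(5) pos(2)] mult_strict_right_mono[OF ijk(6) pos(2)]
      mult_strict_right_mono[OF ijk(8) pos(3)] mult_strict_right_mono[OF ijk(9) pos(3)]
    by (simp_all add: n_eq ac_simps)
  then have bounds:
    "0 < n - i * q * r - j * p * r - k * p * q" "n - i * q * r - j * p * r - k * p * q < n"
    "0 < j * p * r - i * q * r + k * p * q" "j * p * r - i * q * r + k * p * q < n"
    "0 < i * q * r - j * p * r + k * p * q" "i * q * r - j * p * r + k * p * q < n"
    "0 < i * q * r + j * p * r - k * p * q" "i * q * r + j * p * r - k * p * q < n"
    by linarith+
  have "s * a mod n = n - i * q * r - j * p * r - k * p * q"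
    using bounds
    by (intro scaled_mod_eq[OF s(2), where ?e1.0 = 1 and ?e2.0 = 1 and ?e3.0 = 1])
      (auto simp: cong_iff_dvd_diff)
  moreover have "s * b mod n = j * p * r - i * q * r + k * p * q"
    using bounds *
    by (intro scaled_mod_eq[OF s(2), where ?e1.0 = 1 and ?e2.0 = "-1" and ?e3.0 = "-1"]) auto
  moreover have "s * c mod n = i * q * r - j * p * r + k * p * q"
    using bounds *
    by (intro scaled_mod_eq[OF s(2), where ?e1.0 = "-1" and ?e2.0 = 1 and ?e3.0 = "-1"]) auto
  moreover have "s * d mod n = i * q * r + j * p * r - k * p * q"
    using bounds *
    by (intro scaled_mod_eq[OF s(2), where ?e1.0 = "-1" and ?e2.0 = "-1" and ?e3.0 = 1]) auto
  ultimately have "s * a mod n + s * b mod n + s * c mod n + s * d mod n = n"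
    by simp
  with s(1) show ?thesis by blast
qed

text \<open>
  No pairing can serve two of the primes, since the pair would then have sum zero modulo \<open>n\<close>.
\<close>

lemma unit_norm_one_A3_pairings:
  assumes a: "coprime a n" and sum: "n dvd a + b + c + d"
    and pair: "q * r dvd a + b \<or> q * r dvd a + c \<or> q * r dvd a + d"
      "p * r dvd a + b \<or> p * r dvd a + c \<or> p * r dvd a + d"
      "p * q dvd a + b \<or> p * q dvd a + c \<or> p * q dvd a + d"
    and ndvd: "\<not> n dvd a + b" "\<not> n dvd a + c" "\<not> n dvd a + d"
  shows "\<exists>t. coprime t n \<and> t * a mod n + t * b mod n + t * c mod n + t * d mod n = n"
proof -
  have excl: "\<not> (q * r dvd z \<and> p * r dvd z)" "\<not> (q * r dvd z \<and> p * q dvd z)"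
    "\<not> (p * r dvd z \<and> p * q dvd z)" if "\<not> n dvd z" for z
    using that dvd_nI[of z] by (auto dest: dvd_mult_left dvd_mult_right)
  have sums: "n dvd a + b + d + c" "n dvd a + c + b + d" "n dvd a + c + d + b"
    "n dvd a + d + b + c" "n dvd a + d + c + b"
    using sum by (simp_all add: ac_simps)
  \<comment> \<open>Three different pairs are matched with three primes, which leaves six
    bijections, each settled by \<open>unit_norm_one_A3\<close> after renaming \<open>b\<close>,
    \<open>c\<close>, \<open>d\<close>.\<close>
  consider "q * r dvd a + b" "p * r dvd a + c" "p * q dvd a + d"
    | "q * r dvd a + b" "p * r dvd a + d" "p * q dvd a + c"
    | "q * r dvd a + c" "p * r dvd a + b" "p * q dvd a + d"
    | "q * r dvd a + c" "p * r dvd a + d" "p * q dvd a + b"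
    | "q * r dvd a + d" "p * r dvd a + b" "p * q dvd a + c"
    | "q * r dvd a + d" "p * r dvd a + c" "p * q dvd a + b"
    using pair excl[OF ndvd(1)] excl[OF ndvd(2)] excl[OF ndvd(3)] by blast
  then show ?thesis
  proof cases
    case 1
    then show ?thesis using unit_norm_one_A3[OF a, of b c d] sum by simp
  next
    case 2
    then show ?thesis using unit_norm_one_A3[OF a, of b d c] sums by (simp add: ac_simps)
  next
    case 3
    then show ?thesis using unit_norm_one_A3[OF a, of c b d] sums by (simp add: ac_simps)
  next
    case 4
    then show ?thesis using unit_norm_one_A3[OF a, of c d b] sums by (simp add: ac_simps)
  next
    case 5
    then show ?thesis using unit_norm_one_A3[OF a, of d b c] sums by (simp add: ac_simps)
  next
    case 6
    then show ?thesis using unit_norm_one_A3[OF a, of d c b] sums by (simp add: ac_simps)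
  qed
qed

end

section \<open>From the residues back to the index\<close>

lemma (in comm_group) seq_index_four_eq_1I:
  assumes fin: "finite (carrier G)" and g: "g \<in> carrier G" "ord g = order G"
    and min: "minimal_zero_sum G (multiples G g {#a, b, c, d#})"
    and unit: "\<exists>t. coprime t (int (order G)) \<and>
      t * int a mod int (order G) + t * int b mod int (order G) +
      t * int c mod int (order G) + t * int d mod int (order G) = int (order G)"
  shows "seq_index G (multiples G g {#a, b, c, d#}) = 1"
proof -
  have sum: "ord g dvd a + b + c + d"
    using min by (simp add: minimal_zero_sum_multiples g(1) add.assoc)
  from unit obtain t where t: "coprime t (int (order G))"
    "t * int a mod int (order G) + t * int b mod int (order G) +
      t * int c mod int (order G) + t * int d mod int (order G) = int (order G)"
    by blast
  show ?thesis
  proof (rule seq_index_eq_1I[OF fin g t(1)])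
    show "\<forall>m\<in>#{#a, b, c, d#}. \<not> order G dvd m"
      using min by (simp add: minimal_zero_sum_four[OF g(1) sum] g(2))
    show "(\<Sum>m\<in>#{#a, b, c, d#}. t * int m mod int (order G)) = int (order G)"
      using t(2) by simp
    show "zero_sum G (multiples G g {#a, b, c, d#})"
      using min by (simp add: minimal_zero_sum_def)
  qed
qed

lemma image_mset_eq_fourD:
  assumes "image_mset f M = {#u, v, w, z#}"
  obtains a b c d where "M = {#a, b, c, d#}" "f a = u" "f b = v" "f c = w" "f d = z"
  using assms by (force dest!: msed_map_invR)

text \<open>Giving the gcds as a multiset leaves the numbering of the coefficients free, so they can
  be named in the order of the listed values, with \<open>a\<close> coprime to
  \<open>n\<close>.\<close>

lemma (in comm_group) reduced_four_seq_index:
  fixes P Q R n :: nat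
  assumes fin: "finite (carrier G)" and g: "g \<in> carrier G" "ord g = order G"
    and primes: "Factorial_Ring.prime P" "Factorial_Ring.prime Q" "Factorial_Ring.prime R"
    and distinct: "P \<noteq> Q" "P \<noteq> R" "Q \<noteq> R"
    and n: "order G = n" "n = P * Q * R" "coprime n 6"
    and min: "minimal_zero_sum G (multiples G g M)"
    and red: "reduced_seq G g M"
    and gcds: "image_mset (\<lambda>m. gcd m n) M \<in>
      {{#1, P, Q, P * Q#}, {#1, 1, 1, 1#}, {#1, P * Q, P * R, Q * R#}}"
  shows "seq_index G (multiples G g M) = 1"
proof -
  interpret pqr: three_primes "int P" "int Q" "int R" "int n"
  proof
    show "coprime (int n) 6"
      using n(3) by (metis coprime_int_iff of_nat_numeral)
  qed (use primes distinct n in auto)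
  obtain a b c d where M: "M = {#a, b, c, d#}" and cases:
      "gcd a n = 1"
      "gcd b n = P \<and> gcd c n = Q \<and> gcd d n = P * Q \<or>
       gcd b n = 1 \<and> gcd c n = 1 \<and> gcd d n = 1 \<or>
       gcd b n = P * Q \<and> gcd c n = P * R \<and> gcd d n = Q * R"
    using gcds by (auto elim!: image_mset_eq_fourD)
  have sum: "n dvd a + b + c + d"
    using min M n g by (simp add: minimal_zero_sum_multiples add.assoc)
  then have sum': "int n dvd int a + int b + int c + int d"
    by (metis of_nat_add of_nat_dvd_iff)
  have a: "coprime (int a) (int n)"
    using cases(1) by (simp add: coprime_iff_gcd_eq_1)
  have dvd_gcd: "m dvd x \<longleftrightarrow> m dvd gcd x n" if "m dvd n" for m x
    using that by simp
  have n_dvd: "P * Q dvd n" "P * R dvd n" "Q * R dvd n" "P dvd n" "Q dvd n" "R dvd n"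
    by (simp_all add: n(2) ac_simps)
  have ndvd: "\<not> P dvd Q" "\<not> P dvd R" "\<not> Q dvd P" "\<not> Q dvd R" "\<not> R dvd P" "\<not> R dvd Q"
    using primes distinct by (metis primes_dvd_imp_eq)+
  have ndvd_PQ: "\<not> R dvd P * Q"
    using ndvd primes by (simp add: prime_dvd_mult_iff)
  have ndvd_1: "\<not> P dvd 1" "\<not> Q dvd 1" "\<not> R dvd 1"
    using primes by (auto simp: not_prime_unit)
  have ndvd_a: "\<not> P dvd a" "\<not> Q dvd a" "\<not> R dvd a"
    using cases(1) ndvd_1 n_dvd by (metis dvd_gcd)+
  then have ndvd_a2: "\<not> P * Q dvd a" "\<not> P * R dvd a" "\<not> Q * R dvd a"
    by (blast dest: dvd_mult_left)+
  note pair = reduced_pair[OF g(1) g(2), unfolded n(1), OF _ _ sum red[unfolded M]]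
  \<comment> \<open>Scaling by \<open>P\<close> kills a term exactly when \<open>Q * R\<close>
    divides its coefficient, and for a divisor of \<open>n\<close> this can be read off the
    gcd.\<close>
  have pair_P: "Q * R dvd a + b \<or> Q * R dvd a + c \<or> Q * R dvd a + d"
    if "\<not> Q * R dvd gcd b n" "\<not> Q * R dvd gcd c n" "\<not> Q * R dvd gcd d n"
    using pair[of P "Q * R"] primes that ndvd_a2 dvd_gcd[OF n_dvd(3)]
    by (simp add: n(2) ac_simps)
  have pair_Q: "P * R dvd a + b \<or> P * R dvd a + c \<or> P * R dvd a + d"
    if "\<not> P * R dvd gcd b n" "\<not> P * R dvd gcd c n" "\<not> P * R dvd gcd d n"
    using pair[of Q "P * R"] primes that ndvd_a2 dvd_gcd[OF n_dvd(2)]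
    by (simp add: n(2) ac_simps)
  have pair_R: "P * Q dvd a + b \<or> P * Q dvd a + c \<or> P * Q dvd a + d"
    if "\<not> P * Q dvd gcd b n" "\<not> P * Q dvd gcd c n" "\<not> P * Q dvd gcd d n"
    using pair[of R "P * Q"] primes that ndvd_a2 dvd_gcd[OF n_dvd(1)]
    by (simp add: n(2) ac_simps)
  have to_int: "int k dvd int x + int y \<longleftrightarrow> k dvd x + y"
    "int k * int l dvd int x + int y \<longleftrightarrow> k * l dvd x + y"
    "int k * int l dvd int x \<longleftrightarrow> k * l dvd x" for k l x y
    by (metis of_nat_add of_nat_mult of_nat_dvd_iff)+
  from cases(2) have "\<exists>t. coprime t (int n) \<and>
      t * int a mod int n + t * int b mod int n + t * int c mod int n + t * int d mod int n = int n"
  proof (elim disjE conjE)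
    assume gcd: "gcd b n = P" "gcd c n = Q" "gcd d n = P * Q"
    have dvd: "P dvd b" "Q dvd c" "P dvd d" "Q dvd d"
      using gcd n_dvd by (simp_all add: dvd_gcd[of P b] dvd_gcd[of Q c] dvd_gcd[of P d] dvd_gcd[of Q d] del: gcd_greatest_iff)
    \<comment> \<open>Scaling by \<open>P\<close> or \<open>Q\<close> kills no term. Since
      \<open>Q\<close> divides \<open>c\<close> and \<open>d\<close> but not \<open>a\<close>, only
      the pair \<open>a + b\<close> remains for \<open>P\<close>; likewise only \<open>a + c\<close>
      remains for \<open>Q\<close>.\<close>
    have "\<not> Q dvd a + c" "\<not> Q dvd a + d" "\<not> P dvd a + b" "\<not> P dvd a + d"
      using dvd ndvd_a by (simp_all add: dvd_add_left_iff)
    moreover have "\<not> Q * R dvd P" "\<not> Q * R dvd Q" "\<not> Q * R dvd P * Q"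
      "\<not> P * R dvd P" "\<not> P * R dvd Q" "\<not> P * R dvd P * Q"
      using ndvd ndvd_PQ by (blast dest: dvd_mult_left dvd_mult_right)+
    ultimately have "Q * R dvd a + b" "P * R dvd a + c"
      using pair_P pair_Q gcd by (metis dvd_mult_left)+
    with dvd show ?thesis
      by (intro pqr.unit_norm_one_A2[OF a sum']) (simp_all add: to_int)
  next
    assume gcd: "gcd b n = 1" "gcd c n = 1" "gcd d n = 1"
    \<comment> \<open>Minimality of the unscaled sequence is what keeps one pair from serving two
      primes.\<close>
    have "\<not> n dvd a + b" "\<not> n dvd a + c" "\<not> n dvd a + d"
      using min sum by (simp_all add: M minimal_zero_sum_four[OF g(1)] g(2) n(1))
    moreover have "\<not> Q * R dvd 1" "\<not> P * R dvd 1" "\<not> P * Q dvd 1"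
      using ndvd_1 by (blast dest: dvd_mult_left)+
    ultimately show ?thesis
      using pair_P pair_Q pair_R gcd
      by (intro pqr.unit_norm_one_A3_pairings[OF a sum']) (simp_all add: to_int)
  next
    assume gcd: "gcd b n = P * Q" "gcd c n = P * R" "gcd d n = Q * R"
    then have "P * Q dvd b" "P * R dvd c" "Q * R dvd d"
      by (metis gcd_dvd1)+
    then show ?thesis
      by (intro pqr.unit_norm_one_A4[OF a sum']) (simp_all add: to_int)
  qed
  then show ?thesis
    using min unfolding M by (intro seq_index_four_eq_1I[OF fin g]) (simp_all add: n(1))
qed

theorem theorem2p3:
  fixes G :: "('a, 'b) monoid_scheme"
    and g :: 'a
    and n :: nat
    and p x :: "nat \<Rightarrow> nat"
    and S :: "'a multiset"
  assumes "\<forall>i\<in>{1..3}. Factorial_Ring.prime (p i)"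
    and "inj_on p {1..3}"
    and "n = p 1 * p 2 * p 3"
    and "gcd n 6 = 1"
    and "n > 1000"
    and "group G"
    and "cyclic_group G"
    and "order G = n"
    and "g \<in> carrier G"
    and "group.ord G g = n"
    and "\<forall>i\<in>{1..4}. 1 \<le> x i \<and> x i \<le> n - 1"
    and "S = multiples G g {#x 1, x 2, x 3, x 4#}"
    and "minimal_zero_sum G S"
    and "reduced_seq G g {#x 1, x 2, x 3, x 4#}"
    and "\<exists>\<pi> \<sigma>. \<pi> permutes {1..3} \<and> \<sigma> permutes {1..4} \<and>
           (let q = p \<circ> \<pi>; y = x \<circ> \<sigma> in
              {#gcd (y 1) n, gcd (y 2) n, gcd (y 3) n, gcd (y 4) n#} = {#1, q 1, q 2, q 1 * q 2#}
            \<or> (\<forall>i\<in>{1..4}. gcd (y i) n = 1)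
            \<or> gcd (y 1) n = 1 \<and> gcd (y 2) n = q 1 * q 2 \<and>
              gcd (y 3) n = q 1 * q 3 \<and> gcd (y 4) n = q 2 * q 3)"
  shows "seq_index G S = 1"
proof -
  interpret group G by fact
  interpret comm_group G
    using assms(7) by (rule cyclic_imp_abelian_group)
  have i3: "{1..3} = {1, 2, 3::nat}" and i4: "{1..4} = {1, 2, 3, 4::nat}"
    by auto
  obtain \<pi> \<sigma> where perm: "\<pi> permutes {1..3}" "\<sigma> permutes {1..4}"
    and cases: "{#gcd (x (\<sigma> 1)) n, gcd (x (\<sigma> 2)) n, gcd (x (\<sigma> 3)) n, gcd (x (\<sigma> 4)) n#} =
        {#1, p (\<pi> 1), p (\<pi> 2), p (\<pi> 1) * p (\<pi> 2)#}
      \<or> (\<forall>i\<in>{1..4}. gcd (x (\<sigma> i)) n = 1)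
      \<or> gcd (x (\<sigma> 1)) n = 1 \<and> gcd (x (\<sigma> 2)) n = p (\<pi> 1) * p (\<pi> 2) \<and>
        gcd (x (\<sigma> 3)) n = p (\<pi> 1) * p (\<pi> 3) \<and> gcd (x (\<sigma> 4)) n = p (\<pi> 2) * p (\<pi> 3)"
    using assms(15) by (auto simp: Let_def)
  define X where "X = {#x 1, x 2, x 3, x 4#}"
  \<comment> \<open>Renumbering by \<open>\<sigma>\<close> permutes the indices and leaves the
    multiset of coefficients unchanged.\<close>
  have "image_mset x (image_mset \<sigma> (mset_set {1..4})) = image_mset x (mset_set {1..4})"
    using perm(2) by (simp add: permutes_image_mset)
  then have X: "X = {#x (\<sigma> 1), x (\<sigma> 2), x (\<sigma> 3), x (\<sigma> 4)#}"
    unfolding X_def i4 by simp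
  have mem: "\<pi> 1 \<in> {1..3}" "\<pi> 2 \<in> {1..3}" "\<pi> 3 \<in> {1..3}"
    using perm(1) by (simp_all only: permutes_in_image) simp_all
  have "inj \<pi>"
    using perm(1) by (rule permutes_inj)
  then have neq: "\<pi> 1 \<noteq> \<pi> 2" "\<pi> 1 \<noteq> \<pi> 3" "\<pi> 2 \<noteq> \<pi> 3"
    by (simp_all add: inj_eq)
  have "prod p {1..3} = prod (p \<circ> \<pi>) {1..3}"
    using perm(1) by (rule prod.permute)
  then have n: "n = p (\<pi> 1) * p (\<pi> 2) * p (\<pi> 3)"
    unfolding i3 using assms(3) by (simp add: ac_simps)
  have gcds: "image_mset (\<lambda>m. gcd m n) X \<in>
      {{#1, p (\<pi> 1), p (\<pi> 2), p (\<pi> 1) * p (\<pi> 2)#}, {#1, 1, 1, 1#},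
       {#1, p (\<pi> 1) * p (\<pi> 2), p (\<pi> 1) * p (\<pi> 3), p (\<pi> 2) * p (\<pi> 3)#}}"
    using cases by (auto simp: X i4)
  have "finite (carrier G)"
    using assms(5,8) order_gt_0_iff_finite by simp
  moreover have "ord g = order G" "coprime n 6"
    using assms(4,8,10) by (simp_all add: coprime_iff_gcd_eq_1)
  moreover have "p (\<pi> 1) \<noteq> p (\<pi> 2)" "p (\<pi> 1) \<noteq> p (\<pi> 3)" "p (\<pi> 2) \<noteq> p (\<pi> 3)"
    using assms(2) mem neq by (simp_all add: inj_on_eq_iff)
  ultimately have "seq_index G (multiples G g X) = 1"
    using assms mem gcds n
    by (intro reduced_four_seq_index[of g "p (\<pi> 1)" "p (\<pi> 2)" "p (\<pi> 3)" n]) (simp_all add: X_def)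
  then show ?thesis
    using assms(12) by (simp add: X_def)
qed

end
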